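(* Let $R$ be a finite non-commutative ring with $1\ne 0$ and let $k\ge 1$. Let $f=f_0+\sum_{i=1}^k f_i\beta_i\in R_k[x]$, where $f_0,\ldots,f_k\in R[x]$, and let $\lambda_{f_0}$ be the assigned polynomial to $f_0$ in the non-commuting variables $y$ and $z$. Then the following statements are equivalent: (1) $f$ is a permutation polynomial on $R_k$; (2) $f_0$ is a permutation polynomial on $R_k$; (3) $f_0$ is a permutation polynomial on $R$ and the function $R\to R$, $b\mapsto\lambda_{f_0}(a,b)$, is surjective for every $a\in R$; (4) $f_0$ is a permutation polynomial on $R$ and the function $R\to R$, $b\mapsto\lambda_{f_0}(a,b)$, is injective for every $a\in R$; (5) $f_0$ is a permutation polynomial on $R$ and the function $[\lambda_{f_0}(y,z)]\colon R\times R\to R$ is a local permutation in the variable $z$.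
   Context: Rings are associative with identity $1\ne 0$. In a polynomial ring $A[x]$ the variable $x$ commutes with the coefficients. For $f=\sum_{i=0}^n a_ix^i\in A[x]$ and $b\in A$, put $f(b)=\sum_{i=0}^n a_ib^i$ (right substitution). $f\in A[x]$ is a permutation polynomial on $A$ if $b\mapsto f(b)$ is a bijection of $A$. A polynomial in $R[x]$ is also regarded as a polynomial in $R_k[x]$. $R_k=R[\beta_1,\ldots,\beta_k]$ (dual numbers in $k$ variables over $R$) is the quotient $R[x_1,\ldots,x_k]/T$, where $T$ is the ideal generated by all $x_ix_j$ ($1\le i,j\le k$) and $\beta_i=x_i+T$. It is the free $R$-algebra with basis $1,\beta_1,\ldots,\beta_k$, with $\beta_i$ central and $\beta_i\beta_j=0$ for all $1\le i,j\le k$. For $g=\sum_{j=0}^n a_jx^j\in R[x]$, the assigned polynomial in non-commuting variables $y,z$ is $\lambda_g(y,z)=\sum_{j=1}^n\sum_{r=1}^j a_j y^{r-1}zy^{j-r}$; $[\lambda_g(y,z)]$ is the function $R\times R\to R$, $(a,b)\mapsto\lambda_g(a,b)=\sum_{j=1}^n\sum_{r=1}^j a_ja^{r-1}ba^{j-r}$. A function $G\colon R\times R\to R$ is a local permutation in the second coordinate (for $[\lambda_g(y,z)]$: "in the variable $z$") if for every $a\in R$ the function $R\to R$, $r\mapsto G(a,r)$, is bijective. *)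

theory Defs
  imports Complex_Main "HOL-Library.Poly_Mapping"
begin

(* The product on 'a poly exists only over commutative coefficients.  The convolution product of
   finitely supported functions does not need commutativity: for an arbitrary ring 'a,
   nat =>0 'a is 'a[x] and ('k =>0 nat) =>0 'a is the polynomial ring over 'a in
   variables indexed by 'k, with the variables commuting with the coefficients. *)

type_synonym 'a upoly = "nat \<Rightarrow>\<^sub>0 'a"
type_synonym ('k, 'a) mpoly = "('k \<Rightarrow>\<^sub>0 nat) \<Rightarrow>\<^sub>0 'a"

definition right_subst :: "'a::ring_1 upoly \<Rightarrow> 'a \<Rightarrow> 'a" where
  "right_subst f b = (\<Sum>i\<in>Poly_Mapping.keys f. Poly_Mapping.lookup f i * b ^ i)"

definition permutation_polynomial :: "'a::ring_1 upoly \<Rightarrow> bool" where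
  "permutation_polynomial f \<longleftrightarrow> bij (right_subst f)"


definition two_sided_ideal :: "'a::ring_1 set \<Rightarrow> bool" where
  "two_sided_ideal I \<longleftrightarrow> 0 \<in> I \<and> (\<forall>p\<in>I. \<forall>q\<in>I. p + q \<in> I) \<and>
     (\<forall>p\<in>I. \<forall>r. r * p \<in> I \<and> p * r \<in> I)"

definition mvar :: "'k \<Rightarrow> ('k, 'a::ring_1) mpoly" where
  "mvar i = Poly_Mapping.single (Poly_Mapping.single i 1) 1"

definition dual_ideal :: "('k, 'a::ring_1) mpoly set" where
  "dual_ideal = two_sided_ideal hull {mvar i * mvar j | i j. True}"

lemma two_sided_ideal_dual_ideal: "two_sided_ideal (dual_ideal :: ('k, 'a::ring_1) mpoly set)"
  unfolding dual_ideal_def by (rule hull_in) (auto simp: two_sided_ideal_def)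

lemma dual_ideal_zero: "0 \<in> dual_ideal"
  and dual_ideal_add: "p \<in> dual_ideal \<Longrightarrow> q \<in> dual_ideal \<Longrightarrow> p + q \<in> dual_ideal"
  and dual_ideal_mult_left: "p \<in> dual_ideal \<Longrightarrow> r * p \<in> dual_ideal"
  and dual_ideal_mult_right: "p \<in> dual_ideal \<Longrightarrow> p * r \<in> dual_ideal"
  using two_sided_ideal_dual_ideal unfolding two_sided_ideal_def by blast+

lemma dual_ideal_uminus: "p \<in> dual_ideal \<Longrightarrow> - p \<in> dual_ideal"
  using dual_ideal_mult_left[of p "- 1"] by simp

lemma lookup_mult_0:
  fixes p q :: "('k, 'a::ring_1) mpoly"
  shows "Poly_Mapping.lookup (p * q) 0 = Poly_Mapping.lookup p 0 * Poly_Mapping.lookup q 0"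
proof -
  have sum_0: "0 = l + m \<longleftrightarrow> l = 0 \<and> m = 0" for l m :: "'k \<Rightarrow>\<^sub>0 nat"
    by (auto simp: poly_mapping_eq_iff fun_eq_iff lookup_add)
  have "(\<Sum>m. Poly_Mapping.lookup q m when 0 = l + m) = (Poly_Mapping.lookup q 0 when l = 0)"
    for l :: "'k \<Rightarrow>\<^sub>0 nat"
  proof (cases "l = 0")
    case True
    then show ?thesis by simp
  next
    case False
    then show ?thesis by (simp add: sum_0)
  qed
  then show ?thesis by (simp add: lookup_mult mult_when)
qed

lemma one_notin_dual_ideal: "(1 :: ('k, 'a::ring_1) mpoly) \<notin> dual_ideal"
proof -
  let ?J = "{p :: ('k, 'a) mpoly. Poly_Mapping.lookup p 0 = 0}"
  have "two_sided_ideal ?J"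
    by (auto simp: two_sided_ideal_def lookup_add lookup_mult_0)
  moreover have "Poly_Mapping.lookup (mvar i :: ('k, 'a) mpoly) 0 = 0" for i
  proof -
    have "Poly_Mapping.single i (1::nat) \<noteq> 0"
      by (metis lookup_single_eq lookup_zero zero_neq_one)
    then show ?thesis
      by (simp add: mvar_def lookup_single)
  qed
  ultimately have "dual_ideal \<subseteq> ?J"
    unfolding dual_ideal_def by (intro hull_minimal) (auto simp: lookup_mult_0)
  then show ?thesis by auto
qed

definition dual_rel :: "('k, 'a::ring_1) mpoly \<Rightarrow> ('k, 'a) mpoly \<Rightarrow> bool" where
  "dual_rel p q \<longleftrightarrow> p - q \<in> dual_ideal"

lemma equivp_dual_rel: "equivp (dual_rel :: ('k, 'a::ring_1) mpoly \<Rightarrow> _)" (is "equivp ?rel")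
proof (rule equivpI)
  show "reflp ?rel"
    by (simp add: reflp_def dual_rel_def dual_ideal_zero)
  show "symp ?rel"
    unfolding symp_def dual_rel_def by (metis dual_ideal_uminus minus_diff_eq)
  show "transp ?rel"
  proof (rule transpI)
    fix p q r :: "('k, 'a) mpoly"
    assume "dual_rel p q" "dual_rel q r"
    then have "(p - q) + (q - r) \<in> dual_ideal"
      unfolding dual_rel_def by (rule dual_ideal_add)
    then show "dual_rel p r"
      by (simp add: dual_rel_def)
  qed
qed

(* The variables are indexed by the type 'k, so their number is CARD('k). *)

quotient_type (overloaded) ('a, 'k) dual_numbers = "('k, 'a::ring_1) mpoly" / dual_rel
  by (rule equivp_dual_rel)

instantiation dual_numbers :: (ring_1, type) ring_1
begin

lift_definition zero_dual_numbers :: "('a, 'b) dual_numbers" is 0 .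

lift_definition one_dual_numbers :: "('a, 'b) dual_numbers" is 1 .

lift_definition plus_dual_numbers ::
  "('a, 'b) dual_numbers \<Rightarrow> ('a, 'b) dual_numbers \<Rightarrow> ('a, 'b) dual_numbers" is plus
  by (simp add: dual_rel_def add_diff_add dual_ideal_add)

lift_definition uminus_dual_numbers :: "('a, 'b) dual_numbers \<Rightarrow> ('a, 'b) dual_numbers" is uminus
  unfolding dual_rel_def minus_diff_minus by (rule dual_ideal_uminus)

lift_definition minus_dual_numbers ::
  "('a, 'b) dual_numbers \<Rightarrow> ('a, 'b) dual_numbers \<Rightarrow> ('a, 'b) dual_numbers" is minus
proof -
  fix p p' q q' :: "('b, 'a) mpoly"
  assume "dual_rel p p'" "dual_rel q q'"
  then have "(p - p') + - (q - q') \<in> dual_ideal"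
    unfolding dual_rel_def by (intro dual_ideal_add dual_ideal_uminus)
  then show "dual_rel (p - q) (p' - q')"
    unfolding dual_rel_def by (simp add: algebra_simps)
qed

lift_definition times_dual_numbers ::
  "('a, 'b) dual_numbers \<Rightarrow> ('a, 'b) dual_numbers \<Rightarrow> ('a, 'b) dual_numbers" is times
proof -
  fix p p' q q' :: "('b, 'a) mpoly"
  assume "dual_rel p p'" "dual_rel q q'"
  then have "(p - p') * q + p' * (q - q') \<in> dual_ideal"
    unfolding dual_rel_def by (intro dual_ideal_add dual_ideal_mult_left dual_ideal_mult_right)
  then show "dual_rel (p * q) (p' * q')"
    unfolding dual_rel_def by (simp add: algebra_simps)
qed

instance
proof
  fix a b c :: "('a, 'b) dual_numbers"
  have refl: "p = q \<Longrightarrow> dual_rel p q" for p q :: "('b, 'a) mpoly"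
    by (simp add: dual_rel_def dual_ideal_zero)
  show "a + b + c = a + (b + c)" by transfer (rule refl, simp add: ac_simps distrib_left distrib_right)
  show "a + b = b + a" by transfer (rule refl, simp add: ac_simps distrib_left distrib_right)
  show "0 + a = a" by transfer (rule refl, simp)
  show "- a + a = 0" by transfer (rule refl, simp)
  show "a - b = a + - b" by transfer (rule refl, simp)
  show "a * b * c = a * (b * c)" by transfer (rule refl, simp add: ac_simps distrib_left distrib_right)
  show "1 * a = a" by transfer (rule refl, simp)
  show "a * 1 = a" by transfer (rule refl, simp)
  show "(a + b) * c = a * c + b * c" by transfer (rule refl, simp add: ac_simps distrib_left distrib_right)
  show "a * (b + c) = a * b + a * c" by transfer (rule refl, simp add: ac_simps distrib_left distrib_right)
  show "(0 :: ('a, 'b) dual_numbers) \<noteq> 1"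
  proof transfer
    show "\<not> dual_rel (0 :: ('b, 'a) mpoly) 1"
      using dual_ideal_uminus[of "- 1 :: ('b, 'a) mpoly"] one_notin_dual_ideal
      by (auto simp: dual_rel_def)
  qed
qed

end

lift_definition dual_const :: "'a::ring_1 \<Rightarrow> ('a, 'k) dual_numbers" is
  "\<lambda>a. Poly_Mapping.single 0 a" .

lift_definition dual_beta :: "'k \<Rightarrow> ('a::ring_1, 'k) dual_numbers" is mvar .

lemma dual_beta_mult_dual_beta: "dual_beta i * dual_beta j = (0 :: ('a::ring_1, 'k) dual_numbers)"
proof transfer
  fix i j :: 'k
  show "dual_rel (mvar i * mvar j) (0 :: ('k, 'a) mpoly)"
    unfolding dual_rel_def dual_ideal_def by (auto intro: hull_inc)
qed

(* Inclusion of R[x] in R_k[x], applied coefficientwise. *)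

definition dual_lift :: "'a::ring_1 upoly \<Rightarrow> ('a, 'k) dual_numbers upoly" where
  "dual_lift f = Poly_Mapping.map dual_const f"


(* A polynomial in the non-commuting variables y and z is a finitely supported function on the
   words in the two letters. *)

datatype ncvar = Y | Z

type_synonym 'a ncpoly = "ncvar list \<Rightarrow>\<^sub>0 'a"

definition ncpoly_fun :: "'a::ring_1 ncpoly \<Rightarrow> 'a \<Rightarrow> 'a \<Rightarrow> 'a" where
  "ncpoly_fun p a b =
     (\<Sum>w\<in>Poly_Mapping.keys p.
        Poly_Mapping.lookup p w * prod_list (map (case_ncvar a b) w))"

definition assigned_ncpoly :: "'a::ring_1 upoly \<Rightarrow> 'a ncpoly" where
  "assigned_ncpoly g =
     (\<Sum>j\<in>Poly_Mapping.keys g. \<Sum>r = 1..j.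
        Poly_Mapping.single (replicate (r - 1) Y @ Z # replicate (j - r) Y)
          (Poly_Mapping.lookup g j))"

lemma ncpoly_fun_superset:
  assumes "finite W" "Poly_Mapping.keys p \<subseteq> W"
  shows "ncpoly_fun p a b =
    (\<Sum>w\<in>W. Poly_Mapping.lookup p w * prod_list (map (case_ncvar a b) w))"
  unfolding ncpoly_fun_def using assms
  by (intro sum.mono_neutral_left) (auto simp: in_keys_iff)

lemma ncpoly_fun_add: "ncpoly_fun (p + q) a b = ncpoly_fun p a b + ncpoly_fun q a b"
proof -
  let ?W = "Poly_Mapping.keys p \<union> Poly_Mapping.keys q"
  have "finite ?W" by simp
  then show ?thesis
    using keys_add[of p q]
    by (simp add: ncpoly_fun_superset[of ?W] lookup_add distrib_right sum.distrib)
qed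

lemma ncpoly_fun_zero: "ncpoly_fun 0 a b = 0"
  by (simp add: ncpoly_fun_def)

lemma ncpoly_fun_sum: "ncpoly_fun (\<Sum>i\<in>I. p i) a b = (\<Sum>i\<in>I. ncpoly_fun (p i) a b)"
  by (induction I rule: infinite_finite_induct) (simp_all add: ncpoly_fun_add ncpoly_fun_zero)

lemma ncpoly_fun_single:
  "ncpoly_fun (Poly_Mapping.single w c) a b = c * prod_list (map (case_ncvar a b) w)"
  by (simp add: ncpoly_fun_def)

lemma ncpoly_fun_assigned_ncpoly:
  "ncpoly_fun (assigned_ncpoly g) a b =
     (\<Sum>j\<in>Poly_Mapping.keys g. \<Sum>r = 1..j.
        Poly_Mapping.lookup g j * a ^ (r - 1) * b * a ^ (j - r))"
  by (simp add: assigned_ncpoly_def ncpoly_fun_sum ncpoly_fun_single mult.assoc)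

definition local_permutation_snd :: "('a \<Rightarrow> 'a \<Rightarrow> 'a) \<Rightarrow> bool" where
  "local_permutation_snd G \<longleftrightarrow> (\<forall>a. bij (G a))"

end

theory Submission
  imports Defs
begin

text \<open>
  In the coordinates of the basis $1, \beta_1, \ldots, \beta_k$, substituting
  $a + \sum_i b_i \beta_i$ into $f$ gives
  $f_0(a) + \sum_i (\lambda_{f_0}(a, b_i) + f_i(a)) \beta_i$: the terms of a power that contain
  two of the $\beta_i$ vanish, and $\lambda_{f_0}$ collects those that contain exactly one.
  Such a map is a bijection iff $f_0$ is a bijection of $R$ and all the maps
  $\lambda_{f_0}(a, \cdot)$ are, whatever the translations $f_i(a)$; on the finite ring $R$
  injectivity, surjectivity and bijectivity agree.
\<close>

section \<open>Coordinates on the dual numbers\<close>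

lemma single_1_neq_0: "Poly_Mapping.single i (1 :: nat) \<noteq> 0"
  by (metis lookup_single_eq lookup_zero zero_neq_one)

text \<open>An exponent of total degree one cannot be shared between two factors. Hence only two
  terms of the convolution product reach a linear coefficient.\<close>

lemma single_1_eq_add_iff:
  fixes l m :: "'k \<Rightarrow>\<^sub>0 nat"
  shows "Poly_Mapping.single i 1 = l + m \<longleftrightarrow>
    (l = 0 \<and> m = Poly_Mapping.single i 1) \<or> (l = Poly_Mapping.single i 1 \<and> m = 0)"
proof
  assume eq: "Poly_Mapping.single i 1 = l + m"
  have lm: "Poly_Mapping.lookup l j + Poly_Mapping.lookup m j = (1 when i = j)" for j
    by (metis eq lookup_add lookup_single)
  then have off: "Poly_Mapping.lookup l j = 0 \<and> Poly_Mapping.lookup m j = 0" if "j \<noteq> i" for j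
    using that by (metis add_is_0 when_simps(2))
  from lm[of i] have "(Poly_Mapping.lookup l i = 0 \<and> Poly_Mapping.lookup m i = 1) \<or>
      (Poly_Mapping.lookup l i = 1 \<and> Poly_Mapping.lookup m i = 0)"
    by auto
  then show "(l = 0 \<and> m = Poly_Mapping.single i 1) \<or> (l = Poly_Mapping.single i 1 \<and> m = 0)"
  proof
    assume "Poly_Mapping.lookup l i = 0 \<and> Poly_Mapping.lookup m i = 1"
    then have "Poly_Mapping.lookup l j = 0" "Poly_Mapping.lookup m j = (1 when i = j)" for j
      using off[of j] by (cases "j = i"; simp)+
    then show ?thesis by (simp add: poly_mapping_eq_iff fun_eq_iff lookup_single)
  next
    assume "Poly_Mapping.lookup l i = 1 \<and> Poly_Mapping.lookup m i = 0"
    then have "Poly_Mapping.lookup m j = 0" "Poly_Mapping.lookup l j = (1 when i = j)" for j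
      using off[of j] by (cases "j = i"; simp)+
    then show ?thesis by (simp add: poly_mapping_eq_iff fun_eq_iff lookup_single)
  qed
qed auto

lemma lookup_mult_single_1:
  fixes p q :: "('k, 'a::ring_1) mpoly"
  shows "Poly_Mapping.lookup (p * q) (Poly_Mapping.single i 1) =
    Poly_Mapping.lookup p 0 * Poly_Mapping.lookup q (Poly_Mapping.single i 1) +
    Poly_Mapping.lookup p (Poly_Mapping.single i 1) * Poly_Mapping.lookup q 0"
proof -
  define e where "e = Poly_Mapping.single i (1 :: nat)"
  have e: "e \<noteq> 0" "\<And>l m. e = l + m \<longleftrightarrow> (l = 0 \<and> m = e) \<or> (l = e \<and> m = 0)"
    unfolding e_def by (rule single_1_neq_0 single_1_eq_add_iff)+
  have inner: "(\<Sum>m. Poly_Mapping.lookup q m when e = l + m) =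
      (Poly_Mapping.lookup q e when l = 0) + (Poly_Mapping.lookup q 0 when l = e)" for l
  proof -
    consider "l = 0" | "l = e" | "l \<noteq> 0" "l \<noteq> e" by blast
    then show ?thesis
      by cases (simp_all add: e)
  qed
  have fin: "finite {l. (Poly_Mapping.lookup p l * c when l = d) \<noteq> 0}" for c d
    by (rule finite_subset[of _ "{d}"]) auto
  show ?thesis
    unfolding e_def[symmetric] lookup_mult inner distrib_left mult_when
    by (subst Sum_any.distrib[OF fin fin]) simp
qed

text \<open>The polynomials without constant and linear terms form a two-sided ideal that contains
  every product of two variables, so it contains the ideal generated by them. This is what makes the
  coordinates below well defined on the quotient.\<close>

lemma dual_ideal_coeffs:
  assumes "p \<in> (dual_ideal :: ('k, 'a::ring_1) mpoly set)"
  shows "Poly_Mapping.lookup p 0 = 0" "Poly_Mapping.lookup p (Poly_Mapping.single i 1) = 0"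
proof -
  let ?J = "{p :: ('k, 'a) mpoly. Poly_Mapping.lookup p 0 = 0 \<and>
    (\<forall>i. Poly_Mapping.lookup p (Poly_Mapping.single i 1) = 0)}"
  have "two_sided_ideal ?J"
    unfolding two_sided_ideal_def mem_Collect_eq Ball_def
    by (simp add: lookup_add lookup_mult_0 lookup_mult_single_1 del: One_nat_def)
  moreover have "Poly_Mapping.lookup (mvar i :: ('k, 'a) mpoly) 0 = 0" for i
    using single_1_neq_0[of i] by (simp add: mvar_def lookup_single)
  ultimately have "dual_ideal \<subseteq> ?J"
    unfolding dual_ideal_def
    by (intro hull_minimal) (auto simp: lookup_mult_0 lookup_mult_single_1 simp del: One_nat_def)
  then show "Poly_Mapping.lookup p 0 = 0" "Poly_Mapping.lookup p (Poly_Mapping.single i 1) = 0"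
    using assms by auto
qed

section \<open>Coordinate functions on the quotient\<close>

lift_definition dual_coeff_0 :: "('a::ring_1, 'k) dual_numbers \<Rightarrow> 'a"
  is "\<lambda>p. Poly_Mapping.lookup p 0"
  unfolding dual_rel_def using dual_ideal_coeffs(1) by (metis lookup_minus eq_iff_diff_eq_0)

lift_definition dual_coeff :: "('a::ring_1, 'k) dual_numbers \<Rightarrow> 'k \<Rightarrow> 'a"
  is "\<lambda>p i. Poly_Mapping.lookup p (Poly_Mapping.single i 1)"
  unfolding dual_rel_def fun_eq_iff
  using dual_ideal_coeffs(2) by (metis lookup_minus eq_iff_diff_eq_0)

lemma dual_coeff_0_add: "dual_coeff_0 (x + y) = dual_coeff_0 x + dual_coeff_0 y"
  by transfer (rule lookup_add)

lemma dual_coeff_add: "dual_coeff (x + y) i = dual_coeff x i + dual_coeff y i"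
  by transfer (rule lookup_add)

lemma dual_coeff_0_zero [simp]: "dual_coeff_0 0 = 0"
  by transfer simp

lemma dual_coeff_zero [simp]: "dual_coeff 0 i = 0"
  by transfer simp

lemma dual_coeff_0_sum: "dual_coeff_0 (\<Sum>j\<in>J. h j) = (\<Sum>j\<in>J. dual_coeff_0 (h j))"
  by (induction J rule: infinite_finite_induct) (simp_all add: dual_coeff_0_add)

lemma dual_coeff_sum: "dual_coeff (\<Sum>j\<in>J. h j) i = (\<Sum>j\<in>J. dual_coeff (h j) i)"
  by (induction J rule: infinite_finite_induct) (simp_all add: dual_coeff_add)

lemma dual_coeff_0_mult: "dual_coeff_0 (x * y) = dual_coeff_0 x * dual_coeff_0 y"
  by transfer (rule lookup_mult_0)

lemma dual_coeff_mult:
  "dual_coeff (x * y) i = dual_coeff_0 x * dual_coeff y i + dual_coeff x i * dual_coeff_0 y"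
  by transfer (rule lookup_mult_single_1)

lemma dual_coeff_0_const [simp]: "dual_coeff_0 (dual_const a) = a"
  by transfer simp

lemma dual_coeff_const [simp]: "dual_coeff (dual_const a) i = 0"
  by transfer (use single_1_neq_0 in \<open>metis lookup_single_not_eq\<close>)

lemma dual_coeff_0_beta [simp]: "dual_coeff_0 (dual_beta i) = 0"
  by transfer (use single_1_neq_0 in \<open>metis lookup_single_not_eq mvar_def\<close>)

lemma dual_coeff_beta: "dual_coeff (dual_beta i) j = (if i = j then 1 else 0)"
proof transfer
  fix i j :: 'k
  have "Poly_Mapping.single i (1 :: nat) = Poly_Mapping.single j 1 \<longleftrightarrow> i = j"
    by (metis lookup_single_eq lookup_single_not_eq zero_neq_one)
  then show "Poly_Mapping.lookup (mvar i :: ('k, 'a) mpoly) (Poly_Mapping.single j 1) =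
      (if i = j then 1 else 0)"
    by (simp add: mvar_def lookup_single)
qed

section \<open>The normal form and independence of the basis\<close>

definition dual_of :: "'a::ring_1 \<Rightarrow> ('k::finite \<Rightarrow> 'a) \<Rightarrow> ('a, 'k) dual_numbers" where
  "dual_of a b = dual_const a + (\<Sum>i\<in>UNIV. dual_const (b i) * dual_beta i)"

lemma dual_coeff_0_dual_of [simp]: "dual_coeff_0 (dual_of a b) = a"
  by (simp add: dual_of_def dual_coeff_0_add dual_coeff_0_sum dual_coeff_0_mult)

lemma dual_coeff_dual_of [simp]: "dual_coeff (dual_of a b) i = b i"
  by (simp add: dual_of_def dual_coeff_add dual_coeff_sum dual_coeff_mult dual_coeff_beta
      if_distrib[of "times _"] cong: if_cong)

text \<open>This is the linear independence of the basis: the coordinate functions recover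
  \<open>a\<close> and \<open>b\<close> from \<open>dual_of a b\<close>.\<close>

lemma dual_of_eq_iff: "dual_of a b = dual_of a' b' \<longleftrightarrow> a = a' \<and> b = b'"
  by (metis dual_coeff_0_dual_of dual_coeff_dual_of ext)

lemma dual_const_add: "dual_const (a + b) = dual_const a + dual_const b"
  by transfer (simp add: single_add dual_rel_def dual_ideal_zero)

lemma dual_const_0 [simp]: "dual_const 0 = 0"
  by transfer (simp add: dual_rel_def dual_ideal_zero)

lemma dual_const_1: "dual_const 1 = 1"
  by transfer (simp add: dual_rel_def dual_ideal_zero)

lemma dual_of_add: "dual_of a b + dual_of a' b' = dual_of (a + a') (\<lambda>i. b i + b' i)"
  by (simp add: dual_of_def dual_const_add distrib_right sum.distrib)

lemma dual_of_0: "dual_of 0 (\<lambda>i. 0) = 0"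
  by (simp add: dual_of_def)

lemma dual_of_const: "dual_const a = dual_of a (\<lambda>i. 0)"
  by (simp add: dual_of_def)

lemma dual_beta_dual_of: "dual_const a * dual_beta i = dual_of 0 (\<lambda>j. if j = i then a else 0)"
proof -
  have "(\<Sum>j\<in>UNIV. dual_const (if j = i then a else 0) * dual_beta j) =
      (\<Sum>j\<in>UNIV. if j = i then dual_const a * dual_beta j else 0)"
    by (rule sum.cong) auto
  then show ?thesis by (simp add: dual_of_def)
qed

lemma dual_of_sum:
  "(\<Sum>j\<in>J. dual_of (a j) (b j)) = dual_of (\<Sum>j\<in>J. a j) (\<lambda>i. \<Sum>j\<in>J. b j i)"
  by (induction J rule: infinite_finite_induct) (simp_all add: dual_of_add dual_of_0)

section \<open>Spanning by the basis\<close>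

lemma nonzero_monomial_split:
  fixes m :: "'k \<Rightarrow>\<^sub>0 nat"
  assumes "m \<noteq> 0"
  obtains i m' where "m = Poly_Mapping.single i 1 + m'"
proof -
  obtain i where i: "Poly_Mapping.lookup m i \<noteq> 0"
    using assms by (auto simp: poly_mapping_eq_iff fun_eq_iff)
  \<comment> \<open>The subtraction of exponents is truncated; nothing is lost because the exponent
    at \<open>i\<close> is nonzero.\<close>
  have "m = Poly_Mapping.single i 1 + (m - Poly_Mapping.single i 1)"
    using i by (auto simp: poly_mapping_eq_iff fun_eq_iff lookup_add lookup_minus lookup_single
        when_def)
  then show thesis by (rule that)
qed

text \<open>Updating at a fresh key is the same as adding a monomial, so the rule follows from
  induction over updates.\<close>

lemma poly_mapping_single_add_induct [case_names zero add]:
  assumes "P 0" "\<And>k v f. P f \<Longrightarrow> P (Poly_Mapping.single k v + f)"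
  shows "P (f :: 'b \<Rightarrow>\<^sub>0 'a::comm_monoid_add)"
proof (induction f rule: update_induct)
  case const
  show ?case by (rule assms(1))
next
  case (update f k v)
  then have "Poly_Mapping.update k v f = Poly_Mapping.single k v + f"
    by (auto simp: poly_mapping_eq_iff fun_eq_iff lookup_update lookup_add lookup_single
        in_keys_iff when_def)
  then show ?case using assms(2) update by simp
qed

text \<open>Split by total degree: degree zero gives a constant, degree one a multiple of some
  \<open>dual_beta i\<close>, and any higher degree contains a product of two such elements and
  vanishes.\<close>

lemma abs_dual_monomial:
  fixes m :: "'k::finite \<Rightarrow>\<^sub>0 nat" and c :: "'a::ring_1"
  shows "\<exists>a b. abs_dual_numbers (Poly_Mapping.single m c) = dual_of a b"
proof (cases "m = 0")
  case True
  then have "abs_dual_numbers (Poly_Mapping.single m c) = dual_const c"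
    by (simp add: dual_const.abs_eq)
  then show ?thesis using dual_of_const by metis
next
  case False
  then obtain i m' where m: "m = Poly_Mapping.single i 1 + m'"
    by (rule nonzero_monomial_split)
  show ?thesis
  proof (cases "m' = 0")
    case True
    then have "Poly_Mapping.single m c = Poly_Mapping.single 0 c * mvar i"
      by (simp add: m mvar_def mult_single)
    then have "abs_dual_numbers (Poly_Mapping.single m c) = dual_const c * dual_beta i"
      by (simp add: dual_const.abs_eq dual_beta.abs_eq times_dual_numbers.abs_eq)
    then show ?thesis using dual_beta_dual_of by metis
  next
    case False
    then obtain j m'' where m': "m' = Poly_Mapping.single j 1 + m''"
      by (rule nonzero_monomial_split)
    have "Poly_Mapping.single m c = mvar i * mvar j * Poly_Mapping.single m'' c"
      by (simp add: m m' mvar_def mult_single add.assoc)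
    then have "abs_dual_numbers (Poly_Mapping.single m c) =
        dual_beta i * dual_beta j * abs_dual_numbers (Poly_Mapping.single m'' c)"
      by (simp add: dual_beta.abs_eq times_dual_numbers.abs_eq)
    also have "\<dots> = dual_of 0 (\<lambda>i. 0)"
      by (simp add: dual_beta_mult_dual_beta dual_of_0)
    finally show ?thesis by blast
  qed
qed

text \<open>Every polynomial is a sum of monomials, each monomial has a normal form modulo the
  ideal, and normal forms are closed under addition.\<close>

lemma dual_of_surj: "\<exists>a b. (x :: ('a::ring_1, 'k::finite) dual_numbers) = dual_of a b"
proof (induction x rule: dual_numbers.abs_induct)
  case (1 p)
  show ?case
  proof (induction p rule: poly_mapping_single_add_induct)
    case zero
    show ?case by (metis dual_of_0 zero_dual_numbers_def)
  next
    case (add m c p)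
    then show ?case using abs_dual_monomial[of m c]
      by (metis dual_of_add plus_dual_numbers.abs_eq)
  qed
qed

lemma dual_numbers_eqI:
  fixes x y :: "('a::ring_1, 'k::finite) dual_numbers"
  assumes "dual_coeff_0 x = dual_coeff_0 y" "\<And>i. dual_coeff x i = dual_coeff y i"
  shows "x = y"
proof -
  obtain a b a' b' where "x = dual_of a b" "y = dual_of a' b'"
    using dual_of_surj by metis
  then show ?thesis using assms by (simp add: dual_of_eq_iff fun_eq_iff)
qed

section \<open>Products and powers in normal form\<close>

lemma dual_of_mult:
  "dual_of a b * dual_of a' b' = dual_of (a * a') (\<lambda>i. a * b' i + b i * a')"
  by (rule dual_numbers_eqI) (simp_all add: dual_coeff_0_mult dual_coeff_mult)

text \<open>Expanding the power, a surviving term of the \<open>i\<close>-th coordinate takes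
  \<open>b i\<close> from exactly one of the \<open>n\<close> factors, the \<open>r\<close>-th, and
  \<open>a\<close> from all others.\<close>

lemma dual_of_power:
  "dual_of a b ^ n = dual_of (a ^ n) (\<lambda>i. \<Sum>r = 1..n. a ^ (r - 1) * b i * a ^ (n - r))"
proof (induction n)
  case 0
  show ?case by (simp add: dual_of_const[symmetric] dual_const_1)
next
  case (Suc n)
  \<comment> \<open>The new factor stands on the right. Taking \<open>b i\<close> from it yields the
    summand \<open>r = Suc n\<close>; taking \<open>a\<close> lengthens the trailing power in the
    old summands.\<close>
  have "a ^ n * b i + (\<Sum>r = 1..n. a ^ (r - 1) * b i * a ^ (n - r)) * a =
      (\<Sum>r = 1..Suc n. a ^ (r - 1) * b i * a ^ (Suc n - r))" for i
  proof -
    have "(\<Sum>r = 1..n. a ^ (r - 1) * b i * a ^ (n - r)) * a =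
        (\<Sum>r = 1..n. a ^ (r - 1) * b i * a ^ (Suc n - r))"
      unfolding sum_distrib_right
    proof (rule sum.cong)
      fix r assume "r \<in> {1..n}"
      \<comment> \<open>The bound \<open>r \<le> n\<close> is essential here, since subtraction is
        truncated.\<close>
      then have "a ^ (Suc n - r) = a ^ (n - r) * a"
        by (simp only: atLeastAtMost_iff Suc_diff_le power_Suc2)
      then show "a ^ (r - 1) * b i * a ^ (n - r) * a = a ^ (r - 1) * b i * a ^ (Suc n - r)"
        by (simp only: mult.assoc)
    qed simp
    then show ?thesis by (simp add: add.commute)
  qed
  then show ?case
    unfolding power_Suc2 Suc.IH dual_of_mult by (simp only:)
qed

section \<open>Substitution\<close>

lemma right_subst_superset:
  assumes "finite I" "Poly_Mapping.keys f \<subseteq> I"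
  shows "right_subst f b = (\<Sum>i\<in>I. Poly_Mapping.lookup f i * b ^ i)"
  unfolding right_subst_def using assms
  by (intro sum.mono_neutral_left) (auto simp: in_keys_iff)

lemma right_subst_add: "right_subst (f + g) b = right_subst f b + right_subst g b"
proof -
  let ?I = "Poly_Mapping.keys f \<union> Poly_Mapping.keys g"
  have "finite ?I" by simp
  then show ?thesis
    using keys_add[of f g]
    by (simp add: right_subst_superset[of ?I] lookup_add distrib_right sum.distrib)
qed

lemma right_subst_zero: "right_subst 0 b = 0"
  by (simp add: right_subst_def)

lemma right_subst_sum: "right_subst (\<Sum>i\<in>I. f i) b = (\<Sum>i\<in>I. right_subst (f i) b)"
  by (induction I rule: infinite_finite_induct) (simp_all add: right_subst_add right_subst_zero)

lemma right_subst_single: "right_subst (Poly_Mapping.single n c) b = c * b ^ n"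
  by (simp add: right_subst_def)

text \<open>Right substitution is not multiplicative in general. Here a monomial \<open>d\<close>
  times the \<open>n\<close>-th power of the variable contributes \<open>d * c * b ^ n\<close>, and
  \<open>c\<close> can be moved past \<open>b ^ n\<close>. It is applied with \<open>c\<close> one
  of the central elements \<open>dual_beta i\<close>.\<close>

lemma right_subst_mult_central:
  assumes "c * b = b * c"
  shows "right_subst (f * Poly_Mapping.single 0 c) b = right_subst f b * c"
proof (induction f rule: poly_mapping_single_add_induct)
  case zero
  show ?case by (simp add: right_subst_zero)
next
  case (add n d f)
  have "c * b ^ n = b ^ n * c"
    using assms by (metis power_commuting_commutes)
  with add show ?case
    by (simp add: distrib_right right_subst_add mult_single right_subst_single mult.assoc)
qed

lemma dual_beta_commute: "dual_beta i * x = x * dual_beta i"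
  for x :: "('a::ring_1, 'k::finite) dual_numbers"
  by (rule dual_numbers_eqI) (simp_all add: dual_coeff_0_mult dual_coeff_mult dual_coeff_beta)

text \<open>Multiplying the power formula by each coefficient on the left and summing gives, in
  every coordinate, exactly the double sum that evaluates the assigned polynomial.\<close>

lemma right_subst_dual_lift:
  "right_subst (dual_lift g) (dual_of a b) =
    dual_of (right_subst g a) (\<lambda>i. ncpoly_fun (assigned_ncpoly g) a (b i))"
proof -
  have "Poly_Mapping.keys (dual_lift g) \<subseteq> Poly_Mapping.keys g"
    by (auto simp: dual_lift_def in_keys_iff Poly_Mapping.map.rep_eq when_def)
  then have "right_subst (dual_lift g) (dual_of a b) =
      (\<Sum>j\<in>Poly_Mapping.keys g. dual_const (Poly_Mapping.lookup g j) * dual_of a b ^ j)"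
    by (subst right_subst_superset[of "Poly_Mapping.keys g"])
      (auto simp: dual_lift_def Poly_Mapping.map.rep_eq when_def intro!: sum.cong)
  also have "\<dots> = dual_of (right_subst g a) (\<lambda>i. ncpoly_fun (assigned_ncpoly g) a (b i))"
    by (simp add: dual_of_power dual_of_const dual_of_mult dual_of_sum right_subst_def
        ncpoly_fun_assigned_ncpoly sum_distrib_left mult.assoc)
  finally show ?thesis .
qed

text \<open>Multiplication by \<open>dual_beta i\<close> keeps only the constant coordinate, so the
  assigned polynomial of \<open>fs i\<close> drops out and \<open>fs i\<close> acts as a mere
  translation depending on \<open>a\<close>.\<close>

lemma right_subst_dual:
  fixes f0 :: "'a::ring_1 upoly" and fs :: "'k::finite \<Rightarrow> 'a upoly"
  shows "right_subst (dual_lift f0 +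
      (\<Sum>i\<in>UNIV. dual_lift (fs i) * Poly_Mapping.single 0 (dual_beta i))) (dual_of a b) =
    dual_of (right_subst f0 a)
      (\<lambda>i. ncpoly_fun (assigned_ncpoly f0) a (b i) + right_subst (fs i) a)"
  by (rule dual_numbers_eqI)
    (simp_all add: right_subst_add right_subst_sum right_subst_mult_central dual_beta_commute
      right_subst_dual_lift dual_coeff_0_add dual_coeff_add dual_coeff_0_sum dual_coeff_sum
      dual_coeff_0_mult dual_coeff_mult dual_coeff_beta if_distrib[of "times _"] cong: if_cong)

text \<open>\<open>F\<close> maps the fibre over \<open>a\<close> to the fibre over
  \<open>g a\<close>, and inside a fibre it acts on each coordinate separately by \<open>L a\<close>
  followed by a translation, which is always bijective. Finiteness turns surjectivity of
  \<open>g\<close> and \<open>L a\<close> into bijectivity.\<close>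

lemma bij_dual_of_map_iff:
  fixes F :: "('a::{ring_1, finite}, 'k::finite) dual_numbers \<Rightarrow> ('a, 'k) dual_numbers"
  assumes F: "\<And>a b. F (dual_of a b) = dual_of (g a) (\<lambda>i. L a (b i) + t i a)"
  shows "bij F \<longleftrightarrow> bij g \<and> (\<forall>a. bij (L a))"
proof
  assume "bij F"
  \<comment> \<open>This is surjectivity of \<open>F\<close> in coordinates.\<close>
  then have sol: "\<exists>a b. c = g a \<and> d = (\<lambda>i. L a (b i) + t i a)" for c d
    by (metis F bij_pointE dual_of_surj dual_of_eq_iff)
  have "surj g" using sol by (metis surjI)
  then have inj: "inj g" by (simp add: finite_UNIV_surj_inj)
  have "surj (L a)" for a
  proof (rule surjI)
    fix s
    \<comment> \<open>The target lies over \<open>g a\<close> and has the translation already added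
      to \<open>s\<close> in every coordinate, so that it cancels once \<open>a' = a\<close> is
      known.\<close>
    obtain a' b where ab: "g a = g a'" "(\<lambda>i. s + t i a) = (\<lambda>i. L a' (b i) + t i a')"
      using sol by blast
    then have "a' = a" using inj by (simp add: inj_eq)
    \<comment> \<open>Any \<open>b i\<close> is a preimage of \<open>s\<close>; an index
      \<open>i\<close> exists because the type \<open>'k\<close> is nonempty, that is, k \<ge>
      1.\<close>
    with ab(2) show "L a (SOME z. L a z = s) = s"
      by (metis (mono_tags, lifting) add_right_cancel someI)
  qed
  then show "bij g \<and> (\<forall>a. bij (L a))"
    using \<open>surj g\<close> inj by (simp add: bij_def finite_UNIV_surj_inj)
next
  assume bij: "bij g \<and> (\<forall>a. bij (L a))"
  have "inj F"
  proof (rule injI)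
    fix x y assume eq: "F x = F y"
    obtain a b a' b' where xy: "x = dual_of a b" "y = dual_of a' b'"
      using dual_of_surj by metis
    with eq have "g a = g a'" and L: "L a (b i) + t i a = L a' (b' i) + t i a'" for i
      by (auto simp: F dual_of_eq_iff fun_eq_iff)
    then have "a = a'" using bij by (metis bij_pointE)
    moreover from this L have "b i = b' i" for i
      using bij by (metis add_right_cancel bij_pointE)
    ultimately show "x = y" by (simp add: xy dual_of_eq_iff fun_eq_iff)
  qed
  moreover have "\<exists>x. F x = y" for y
  proof -
    obtain c d where y: "y = dual_of c d" using dual_of_surj by metis
    obtain a where a: "g a = c" using bij by (metis bij_pointE)
    \<comment> \<open>With \<open>a\<close> fixed, the coordinates are solved independently, after
      undoing the translation.\<close>
    have "\<exists>z. L a z = d i - t i a" for i using bij by (metis bij_pointE)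
    then obtain b where "\<And>i. L a (b i) = d i - t i a" by metis
    then have "F (dual_of a b) = y" by (simp add: F y a)
    then show ?thesis ..
  qed
  ultimately show "bij F" by (metis bij_def surj_def)
qed

theorem theorem5p4:
  fixes f0 :: "'a::{ring_1, finite} upoly"
    and fs :: "'k::finite \<Rightarrow> 'a upoly"
    and f :: "('a, 'k) dual_numbers upoly"
  assumes noncommutative: "\<exists>a b :: 'a. a * b \<noteq> b * a"
    and f: "f = dual_lift f0 + (\<Sum>i\<in>UNIV. dual_lift (fs i) * Poly_Mapping.single 0 (dual_beta i))"
  shows
    "(permutation_polynomial f \<longleftrightarrow>
        permutation_polynomial (dual_lift f0 :: ('a, 'k) dual_numbers upoly)) \<and>
     (permutation_polynomial f \<longleftrightarrow>
        permutation_polynomial f0 \<and> (\<forall>a. surj (\<lambda>b. ncpoly_fun (assigned_ncpoly f0) a b))) \<and>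
     (permutation_polynomial f \<longleftrightarrow>
        permutation_polynomial f0 \<and> (\<forall>a. inj (\<lambda>b. ncpoly_fun (assigned_ncpoly f0) a b))) \<and>
     (permutation_polynomial f \<longleftrightarrow>
        permutation_polynomial f0 \<and> local_permutation_snd (ncpoly_fun (assigned_ncpoly f0)))"
proof -
  let ?L = "ncpoly_fun (assigned_ncpoly f0)"
  have f_iff: "permutation_polynomial f \<longleftrightarrow> permutation_polynomial f0 \<and> (\<forall>a. bij (?L a))"
    unfolding permutation_polynomial_def f
    by (rule bij_dual_of_map_iff) (rule right_subst_dual)
  \<comment> \<open>Lifting \<open>f0\<close> alone is the case of zero translations. The criterion
    is the same as for \<open>f\<close>, which gives the equivalence of the first two
    statements.\<close>
  have f0_iff: "permutation_polynomial (dual_lift f0 :: ('a, 'k) dual_numbers upoly) \<longleftrightarrow>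
      permutation_polynomial f0 \<and> (\<forall>a. bij (?L a))"
    unfolding permutation_polynomial_def
    by (rule bij_dual_of_map_iff[where t = "\<lambda>_ _. 0"]) (simp add: right_subst_dual_lift)
  \<comment> \<open>On a finite set an injective self-map is surjective and conversely, which
    identifies the last three statements.\<close>
  have "bij (?L a) \<longleftrightarrow> surj (?L a)" "bij (?L a) \<longleftrightarrow> inj (?L a)" for a
    using finite_UNIV_surj_inj[OF finite, of "?L a"] finite_UNIV_inj_surj[OF finite, of "?L a"]
    unfolding bij_def by blast+
  with f_iff f0_iff show ?thesis
    by (simp add: local_permutation_snd_def)
qed

end
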